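(* Let $\mathcal{P}$ and $\{\mathcal{P}_k\}_{k\in\mathbb{N}^*}$ be statistical models on the sample space $\mathcal{Z}$, let $P_0\in\mathcal{P}\subset\mathcal{P}_1$ be the true law of the random vector $Z\in\mathcal{Z}$, and let $\theta_0=\psi(P_0)$, where $\psi:\mathcal{P}_1\to\mathbb{R}^d$ is a map that is differentiable at $P_0$ relative to the tangent cone $\dot{\mathcal{P}}_{1,P_0}$ of $\mathcal{P}_1$ at $P_0$. Suppose that the family $\{\mathcal{P}_k\}_{k\in\mathbb{N}^*}$ is decreasing, with $$\mathcal{P}_1\supset\mathcal{P}_2\supset\cdots\supset\mathcal{P}_k\supset\mathcal{P}_{k+1}\supset\cdots\supset\bigcap_{k=1}^{\infty}\mathcal{P}_k\supset\mathcal{P}\ni P_0,$$ and that $$\bigcap_{k=1}^{\infty}\mathcal{T}_k=\mathcal{T},$$ where $\mathcal{T}=\mathcal{T}(\mathcal{P},P_0)$ and $\mathcal{T}_k=\mathcal{T}(\mathcal{P}_k,P_0)$ are the tangent spaces at $P_0$ of the models $\mathcal{P}$ and $\mathcal{P}_k$, $k\in\mathbb{N}^*$. Then $$I_{\theta_0}(\mathcal{P})=\lim_{k\to\infty}I_{\theta_0}(\mathcal{P}_k),$$ where $I_{\theta_0}(\mathcal{Q})$ denotes the Fisher information on $\theta_0=\psi(P_0)$ in the model $\mathcal{Q}$ at $P_0$.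
   Context: A statistical model on $\mathcal{Z}$ is a collection of probability measures on $\mathcal{Z}$ defined by their densities with respect to some fixed dominating measure. $\mathbb{N}^*=\{1,2,\dots\}$. For a model $\mathcal{Q}\ni P_0$, the tangent cone $\dot{\mathcal{Q}}_{P_0}\subset L^2(P_0)$ is the set of score functions $g$ (in the mean square sense, i.e. differentiability in quadratic mean) at $t=0$ of one-dimensional submodels $(-\varepsilon,\varepsilon)\ni t\mapsto P_t\in\mathcal{Q}$ passing through $P_0$ at $t=0$. The tangent space $\mathcal{T}(\mathcal{Q},P_0)$ is the closure in $L^2(P_0)$ of the linear span of $\dot{\mathcal{Q}}_{P_0}$. The map $\psi$ is differentiable at $P_0$ relative to $\dot{\mathcal{P}}_{1,P_0}$ if there is a continuous linear map $\dot\psi:L^2(P_0)\to\mathbb{R}^d$ such that for every $g\in\dot{\mathcal{P}}_{1,P_0}$ and every submodel $t\mapsto P_t$ of $\mathcal{P}_1$ with score function $g$ at $t=0$, $(\psi(P_t)-\psi(P_0))/t\to\dot\psi(g)$ as $t\to0$. Let $\overline\psi\in[L^2(P_0)]^d$ be the Riesz representer: $\dot\psi(h)=E_{P_0}(\overline\psi h)$ for all $h\in L^2(P_0)$. For $\mathcal{Q}\in\{\mathcal{P},\mathcal{P}_1,\mathcal{P}_2,\dots\}$, let $\widetilde\psi_{\mathcal{Q}}\in[L^2(P_0)]^d$ be the componentwise orthogonal projection of $\overline\psi$ on $\mathcal{T}(\mathcal{Q},P_0)$. The Fisher information matrix $I_{\theta_0}(\mathcal{Q})$ on $\theta_0=\psi(P_0)$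 in $\mathcal{Q}$ at $P_0$ is defined by $I_{\theta_0}^{-1}(\mathcal{Q})=V_{P_0}(\widetilde\psi_{\mathcal{Q}})=E_{P_0}(\widetilde\psi_{\mathcal{Q}}\widetilde\psi_{\mathcal{Q}}')$, these variance matrices being understood to be nonsingular so that the Fisher informations are well defined. *)

theory Defs
  imports "HOL-Probability.Probability"
begin

text \<open>
  Elements of \<open>L\<^sup>2(P)\<close> are represented by functions rather than by classes modulo almost sure
  equality. Accordingly \<open>L2_dist\<close> is only a pseudo-distance, and the closed sets it determines are
  automatically stable under almost sure equality.
\<close>

definition L2 :: "'z measure \<Rightarrow> ('z \<Rightarrow> real) set" where
  "L2 P = {g \<in> borel_measurable P. integrable P (\<lambda>z. (g z)\<^sup>2)}"

definition L2_dist :: "'z measure \<Rightarrow> ('z \<Rightarrow> real) \<Rightarrow> ('z \<Rightarrow> real) \<Rightarrow> real" where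
  "L2_dist P f g = sqrt (\<integral>z. (f z - g z)\<^sup>2 \<partial>P)"

definition L2_closure :: "'z measure \<Rightarrow> ('z \<Rightarrow> real) set \<Rightarrow> ('z \<Rightarrow> real) set" where
  "L2_closure P S = {h \<in> L2 P. \<forall>e>0. \<exists>g\<in>S. L2_dist P h g < e}"

definition linear_span :: "('z \<Rightarrow> real) set \<Rightarrow> ('z \<Rightarrow> real) set" where
  "linear_span S = {(\<lambda>z. \<Sum>i<n. c i * g i z) | (n::nat) c g. \<forall>i<n. g i \<in> S}"

definition L2_continuous_linear ::
    "'z measure \<Rightarrow> (('z \<Rightarrow> real) \<Rightarrow> real ^ 'd) \<Rightarrow> bool" where
  "L2_continuous_linear P L \<longleftrightarrow>
     (\<forall>f\<in>L2 P. \<forall>g\<in>L2 P. L (\<lambda>z. f z + g z) = L f + L g) \<and>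
     (\<forall>f\<in>L2 P. \<forall>c. L (\<lambda>z. c * f z) = c *\<^sub>R L f) \<and>
     (\<forall>f\<in>L2 P. \<forall>e>0. \<exists>\<delta>>0. \<forall>g\<in>L2 P. L2_dist P g f < \<delta> \<longrightarrow> dist (L g) (L f) < e)"

text \<open>
  A model is a set of probability measures having densities with respect to \<open>\<mu>\<close>. The measure \<open>\<mu>\<close>
  need not be \<open>\<sigma>\<close>-finite: the density of a probability measure, when it exists, is
  \<open>\<mu>\<close>-almost everywhere unique and \<^const>\<open>RN_deriv\<close> is a version of it.
\<close>

definition statistical_model :: "'z measure \<Rightarrow> 'z measure set \<Rightarrow> bool" where
  "statistical_model \<mu> Q \<longleftrightarrow>
     (\<forall>P\<in>Q. prob_space P \<and> (\<exists>p\<in>borel_measurable \<mu>. P = density \<mu> p))"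

definition root_density :: "'z measure \<Rightarrow> 'z measure \<Rightarrow> 'z \<Rightarrow> real" where
  "root_density \<mu> P z = sqrt (enn2real (RN_deriv \<mu> P z))"

text \<open>
  \<open>Pt\<close> is a path with score function \<open>g\<close> at \<open>t = 0\<close>, in the sense of differentiability in
  quadratic mean: \<open>\<integral> ((\<surd>p\<^sub>t - \<surd>p\<^sub>0) / t - g \<surd>p\<^sub>0 / 2)\<^sup>2 d\<mu> \<longlongrightarrow> 0\<close>. The values of \<open>Pt\<close> outside
  \<open>(-\<epsilon>, \<epsilon>)\<close> are irrelevant.
\<close>

definition submodel_with_score ::
    "'z measure \<Rightarrow> 'z measure set \<Rightarrow> 'z measure \<Rightarrow> (real \<Rightarrow> 'z measure) \<Rightarrow> ('z \<Rightarrow> real) \<Rightarrow> bool" where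
  "submodel_with_score \<mu> Q P0 Pt g \<longleftrightarrow>
     (\<exists>\<epsilon>>0. \<forall>t\<in>{-\<epsilon><..<\<epsilon>}. Pt t \<in> Q) \<and> Pt 0 = P0 \<and> g \<in> L2 P0 \<and>
     ((\<lambda>t. \<integral>\<^sup>+z. ennreal (((root_density \<mu> (Pt t) z - root_density \<mu> P0 z) / t
              - g z * root_density \<mu> P0 z / 2)\<^sup>2) \<partial>\<mu>) \<longlongrightarrow> 0) (at 0)"

definition tangent_cone :: "'z measure \<Rightarrow> 'z measure set \<Rightarrow> 'z measure \<Rightarrow> ('z \<Rightarrow> real) set" where
  "tangent_cone \<mu> Q P0 = {g. \<exists>Pt. submodel_with_score \<mu> Q P0 Pt g}"

definition tangent_space :: "'z measure \<Rightarrow> 'z measure set \<Rightarrow> 'z measure \<Rightarrow> ('z \<Rightarrow> real) set" where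
  "tangent_space \<mu> Q P0 = L2_closure P0 (linear_span (tangent_cone \<mu> Q P0))"

definition has_derivative_rel_tangent_cone ::
    "'z measure \<Rightarrow> 'z measure set \<Rightarrow> 'z measure \<Rightarrow> ('z measure \<Rightarrow> real ^ 'd) \<Rightarrow>
     (('z \<Rightarrow> real) \<Rightarrow> real ^ 'd) \<Rightarrow> bool" where
  "has_derivative_rel_tangent_cone \<mu> Q P0 \<psi> d\<psi> \<longleftrightarrow>
     L2_continuous_linear P0 d\<psi> \<and>
     (\<forall>g\<in>tangent_cone \<mu> Q P0. \<forall>Pt. submodel_with_score \<mu> Q P0 Pt g \<longrightarrow>
        ((\<lambda>t. (\<psi> (Pt t) - \<psi> P0) /\<^sub>R t) \<longlongrightarrow> d\<psi> g) (at 0))"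

text \<open>
  The functions chosen by \<open>SOME\<close> below exist and are unique up to almost sure equality: the first
  by the Riesz representation theorem, the second by the projection theorem for a closed linear
  subspace \<open>S\<close> of \<open>L\<^sup>2(P)\<close>.
\<close>

definition riesz_representer ::
    "'z measure \<Rightarrow> (('z \<Rightarrow> real) \<Rightarrow> real ^ 'd) \<Rightarrow> 'z \<Rightarrow> real ^ 'd" where
  "riesz_representer P L =
     (SOME b. (\<forall>i. (\<lambda>z. b z $ i) \<in> L2 P) \<and>
              (\<forall>h\<in>L2 P. L h = (\<chi> i. \<integral>z. b z $ i * h z \<partial>P)))"

definition L2_projection ::
    "'z measure \<Rightarrow> ('z \<Rightarrow> real) set \<Rightarrow> ('z \<Rightarrow> real) \<Rightarrow> 'z \<Rightarrow> real" where
  "L2_projection P S f = (SOME q. q \<in> S \<and> (\<forall>g\<in>S. (\<integral>z. (f z - q z) * g z \<partial>P) = 0))"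

definition projected_representer ::
    "'z measure \<Rightarrow> 'z measure \<Rightarrow> (('z \<Rightarrow> real) \<Rightarrow> real ^ 'd) \<Rightarrow> 'z measure set \<Rightarrow> 'z \<Rightarrow> real ^ 'd" where
  "projected_representer \<mu> P0 d\<psi> Q z =
     (\<chi> i. L2_projection P0 (tangent_space \<mu> Q P0) (\<lambda>y. riesz_representer P0 d\<psi> y $ i) z)"

text \<open>
  The second moment matrix is the variance matrix here, since elements of a tangent space have
  mean zero.
\<close>

definition inverse_information ::
    "'z measure \<Rightarrow> 'z measure \<Rightarrow> (('z \<Rightarrow> real) \<Rightarrow> real ^ 'd) \<Rightarrow> 'z measure set \<Rightarrow> real ^ 'd ^ 'd" where
  "inverse_information \<mu> P0 d\<psi> Q =
     (\<chi> i j. \<integral>z. projected_representer \<mu> P0 d\<psi> Q z $ i * projected_representer \<mu> P0 d\<psi> Q z $ j \<partial>P0)"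

text \<open>
  The derivative \<open>d\<psi>\<close> of \<open>\<psi>\<close> relative to the tangent cone of a model is determined only on its
  tangent space; the information in any submodel depends on \<open>d\<psi>\<close> only through these values.
\<close>

definition fisher_information ::
    "'z measure \<Rightarrow> 'z measure \<Rightarrow> (('z \<Rightarrow> real) \<Rightarrow> real ^ 'd) \<Rightarrow> 'z measure set \<Rightarrow> real ^ 'd ^ 'd" where
  "fisher_information \<mu> P0 d\<psi> Q = matrix_inv (inverse_information \<mu> P0 d\<psi> Q)"

end

theory Submission imports Defs begin

text \<open>
  In \<open>L\<^sup>2(P\<^sub>0)\<close> let \<open>q\<^sub>k\<close> be the projections of a fixed element onto a decreasing sequence of closed
  subspaces. For \<open>i \<le> j\<close>, \<open>q\<^sub>j\<close> is also the projection of \<open>q\<^sub>i\<close>, so that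
  \<open>\<parallel>q\<^sub>i - q\<^sub>j\<parallel>\<^sup>2 = \<parallel>q\<^sub>i\<parallel>\<^sup>2 - \<parallel>q\<^sub>j\<parallel>\<^sup>2\<close>. The squared norms decrease, hence converge; therefore \<open>q\<^sub>k\<close> is a
  Cauchy sequence, and its limit is the projection onto the intersection of the subspaces. Applied to
  the tangent spaces and the components of the Riesz representer, this gives convergence of the
  second moment matrices, and matrix inversion is continuous by Cramer's rule.
\<close>

subsection \<open>The semi-inner product on square integrable functions\<close>

text \<open>The form is only positive semidefinite: functions vanishing almost surely have norm 0. A
  product that is not integrable gets the default value 0, hence the \<open>L2\<close> hypotheses in
  the additivity rules below.\<close>

definition L2_inner :: "'z measure \<Rightarrow> ('z \<Rightarrow> real) \<Rightarrow> ('z \<Rightarrow> real) \<Rightarrow> real" where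
  "L2_inner M f g = (\<integral>z. f z * g z \<partial>M)"

lemma L2_measurable [measurable_dest]: "f \<in> L2 M \<Longrightarrow> f \<in> borel_measurable M"
  by (simp add: L2_def)

lemma integrable_L2_mult:
  assumes "f \<in> L2 M" "g \<in> L2 M"
  shows "integrable M (\<lambda>z. f z * g z)"
proof (rule Bochner_Integration.integrable_bound)
  show "integrable M (\<lambda>z. (f z)\<^sup>2 + (g z)\<^sup>2)"
    using assms by (simp add: L2_def)
  show "(\<lambda>z. f z * g z) \<in> borel_measurable M"
    using assms by (auto simp: L2_def)
  have "\<bar>a * b\<bar> \<le> a\<^sup>2 + b\<^sup>2" for a b :: real
    using sum_squares_bound[of "\<bar>a\<bar>" "\<bar>b\<bar>"] mult_nonneg_nonneg[OF abs_ge_zero abs_ge_zero, of a b]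
    unfolding abs_mult power2_abs by linarith
  then show "AE z in M. norm (f z * g z) \<le> norm ((f z)\<^sup>2 + (g z)\<^sup>2)"
    by simp
qed

lemma L2_scale: "f \<in> L2 M \<Longrightarrow> (\<lambda>z. c * f z) \<in> L2 M"
  by (auto simp: L2_def power_mult_distrib)

lemma L2_add:
  assumes "f \<in> L2 M" "g \<in> L2 M"
  shows "(\<lambda>z. f z + g z) \<in> L2 M"
proof -
  have "integrable M (\<lambda>z. (f z)\<^sup>2 + (g z)\<^sup>2 + 2 * (f z * g z))"
    using assms integrable_L2_mult[OF assms] by (auto simp: L2_def)
  then show ?thesis
    using assms by (auto simp: L2_def power2_sum mult.assoc)
qed

lemma L2_diff:
  assumes "f \<in> L2 M" "g \<in> L2 M"
  shows "(\<lambda>z. f z - g z) \<in> L2 M"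
  using L2_add[OF assms(1) L2_scale[OF assms(2), of "-1"]] by simp

lemma L2_zero: "(\<lambda>_. 0) \<in> L2 M"
  by (simp add: L2_def)

lemma L2_sum: "(\<And>i. i < (n::nat) \<Longrightarrow> f i \<in> L2 M) \<Longrightarrow> (\<lambda>z. \<Sum>i<n. f i z) \<in> L2 M"
  by (induction n) (auto intro: L2_zero L2_add)

lemma L2_inner_commute: "L2_inner M f g = L2_inner M g f"
  by (simp add: L2_inner_def mult.commute)

lemma L2_inner_add_left:
  "\<lbrakk>f \<in> L2 M; g \<in> L2 M; h \<in> L2 M\<rbrakk> \<Longrightarrow> L2_inner M (\<lambda>z. f z + g z) h = L2_inner M f h + L2_inner M g h"
  by (simp add: L2_inner_def distrib_right integrable_L2_mult)

lemma L2_inner_diff_left: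
  "\<lbrakk>f \<in> L2 M; g \<in> L2 M; h \<in> L2 M\<rbrakk> \<Longrightarrow> L2_inner M (\<lambda>z. f z - g z) h = L2_inner M f h - L2_inner M g h"
  by (simp add: L2_inner_def left_diff_distrib integrable_L2_mult)

lemma L2_inner_scale_left: "L2_inner M (\<lambda>z. c * f z) h = c * L2_inner M f h"
  by (simp add: L2_inner_def mult.assoc)

lemma L2_inner_add_right:
  "\<lbrakk>f \<in> L2 M; g \<in> L2 M; h \<in> L2 M\<rbrakk> \<Longrightarrow> L2_inner M h (\<lambda>z. f z + g z) = L2_inner M h f + L2_inner M h g"
  by (simp add: L2_inner_commute[of M h] L2_inner_add_left)

lemma L2_inner_diff_right:
  "\<lbrakk>f \<in> L2 M; g \<in> L2 M; h \<in> L2 M\<rbrakk> \<Longrightarrow> L2_inner M h (\<lambda>z. f z - g z) = L2_inner M h f - L2_inner M h g"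
  by (simp add: L2_inner_commute[of M h] L2_inner_diff_left)

lemma L2_inner_scale_right: "L2_inner M h (\<lambda>z. c * f z) = c * L2_inner M h f"
  by (simp add: L2_inner_commute[of M h] L2_inner_scale_left)

lemmas L2_intros = L2_add L2_diff L2_scale L2_zero
lemmas L2_inner_simps = L2_intros
  L2_inner_add_left L2_inner_diff_left L2_inner_scale_left
  L2_inner_add_right L2_inner_diff_right L2_inner_scale_right

lemma L2_inner_self_add:
  assumes "f \<in> L2 M" "g \<in> L2 M"
  shows "L2_inner M (\<lambda>z. f z + g z) (\<lambda>z. f z + g z)
       = L2_inner M f f + L2_inner M g g + 2 * L2_inner M f g"
  using assms by (simp add: L2_inner_simps L2_inner_commute[of M g f])

lemma L2_inner_self_diff:
  assumes "f \<in> L2 M" "g \<in> L2 M"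
  shows "L2_inner M (\<lambda>z. f z - g z) (\<lambda>z. f z - g z)
       = L2_inner M f f + L2_inner M g g - 2 * L2_inner M f g"
  using assms by (simp add: L2_inner_simps L2_inner_commute[of M g f])

lemma L2_inner_self_nonneg: "L2_inner M f f \<ge> 0"
  by (simp add: L2_inner_def)

lemma L2_dist_power2: "(L2_dist M f g)\<^sup>2 = L2_inner M (\<lambda>z. f z - g z) (\<lambda>z. f z - g z)"
  by (simp add: L2_dist_def L2_inner_def power2_eq_square)

lemma L2_dist_nonneg: "L2_dist M f g \<ge> 0"
  by (simp add: L2_dist_def)

lemma L2_dist_commute: "L2_dist M f g = L2_dist M g f"
  by (simp add: L2_dist_def power2_commute)

lemma L2_dist_self: "L2_dist M f f = 0"
  by (simp add: L2_dist_def)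

lemma L2_dist_scale: "L2_dist M (\<lambda>z. c * f z) (\<lambda>z. c * g z) = \<bar>c\<bar> * L2_dist M f g"
proof -
  have "(\<integral>z. (c * f z - c * g z)\<^sup>2 \<partial>M) = c\<^sup>2 * (\<integral>z. (f z - g z)\<^sup>2 \<partial>M)"
    unfolding right_diff_distrib[symmetric] power_mult_distrib by simp
  then show ?thesis
    by (simp add: L2_dist_def real_sqrt_mult)
qed

text \<open>The squared norm of \<open>f - t * g\<close> is a quadratic in \<open>t\<close> that is
  never negative. The case of a null \<open>g\<close> is treated apart, because such a
  \<open>g\<close> need not be the zero function.\<close>

lemma L2_inner_Cauchy_Schwarz_power2:
  assumes f: "f \<in> L2 M" and g: "g \<in> L2 M"
  shows "(L2_inner M f g)\<^sup>2 \<le> L2_inner M f f * L2_inner M g g"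
proof -
  define a b c where "a = L2_inner M f f" and "b = L2_inner M f g" and "c = L2_inner M g g"
  have *: "0 \<le> a - 2 * t * b + t\<^sup>2 * c" for t
  proof -
    have "0 \<le> L2_inner M (\<lambda>z. f z - t * g z) (\<lambda>z. f z - t * g z)"
      by (rule L2_inner_self_nonneg)
    also have "\<dots> = a - 2 * t * b + t\<^sup>2 * c"
      using f g
      by (simp add: L2_inner_simps L2_inner_commute[of M g f] a_def b_def c_def power2_eq_square algebra_simps)
    finally show ?thesis .
  qed
  have "b\<^sup>2 \<le> a * c"
  proof (cases "c = 0")
    case True
    have "b = 0"
    proof (rule ccontr)
      assume "b \<noteq> 0"
      \<comment> \<open>With \<open>c = 0\<close> the quadratic is affine in \<open>t\<close>, and
        this \<open>t\<close> gives it the value -1.\<close>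
      then have "2 * ((a + 1) / (2 * b)) * b = a + 1"
        by simp
      with *[of "(a + 1) / (2 * b)"] True show False
        by simp
    qed
    then show ?thesis using True by simp
  next
    case False
    then have "c > 0" using L2_inner_self_nonneg[of M g] by (simp add: c_def)
    \<comment> \<open>The point \<open>t = b / c\<close> minimises the quadratic.\<close>
    then show ?thesis
      using *[of "b / c"] by (simp add: field_simps power2_eq_square)
  qed
  then show ?thesis by (simp add: a_def b_def c_def)
qed

lemma L2_inner_Cauchy_Schwarz:
  assumes "f \<in> L2 M" "g \<in> L2 M"
  shows "\<bar>L2_inner M f g\<bar> \<le> sqrt (L2_inner M f f) * sqrt (L2_inner M g g)"
  using real_sqrt_le_mono[OF L2_inner_Cauchy_Schwarz_power2[OF assms]]
  by (simp add: real_sqrt_mult)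

lemma L2_dist_eq: "L2_dist M f g = sqrt (L2_inner M (\<lambda>z. f z - g z) (\<lambda>z. f z - g z))"
  by (simp add: L2_dist_def L2_inner_def power2_eq_square)

lemma L2_dist_triangle:
  assumes f: "f \<in> L2 M" and g: "g \<in> L2 M" and h: "h \<in> L2 M"
  shows "L2_dist M f h \<le> L2_dist M f g + L2_dist M g h"
proof (rule power2_le_imp_le)
  let ?u = "\<lambda>z. f z - g z" and ?v = "\<lambda>z. g z - h z"
  have uv: "?u \<in> L2 M" "?v \<in> L2 M"
    using f g h by (auto intro: L2_intros)
  have "(L2_dist M f h)\<^sup>2 = L2_inner M (\<lambda>z. ?u z + ?v z) (\<lambda>z. ?u z + ?v z)"
    by (simp add: L2_dist_power2)
  also have "\<dots> = (L2_dist M f g)\<^sup>2 + (L2_dist M g h)\<^sup>2 + 2 * L2_inner M ?u ?v"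
    unfolding L2_dist_power2 by (rule L2_inner_self_add[OF uv])
  also have "\<dots> \<le> (L2_dist M f g)\<^sup>2 + (L2_dist M g h)\<^sup>2 + 2 * (L2_dist M f g * L2_dist M g h)"
    using L2_inner_Cauchy_Schwarz[OF uv] by (simp add: L2_dist_eq)
  also have "\<dots> = (L2_dist M f g + L2_dist M g h)\<^sup>2"
    by (simp add: power2_sum)
  finally show "(L2_dist M f h)\<^sup>2 \<le> (L2_dist M f g + L2_dist M g h)\<^sup>2" .
qed (simp add: L2_dist_nonneg)

lemma tendsto_L2_inner_right:
  assumes lim: "(\<lambda>n. L2_dist M l (s n)) \<longlonglongrightarrow> 0"
    and s: "\<And>n. s n \<in> L2 M" and l: "l \<in> L2 M" and h: "h \<in> L2 M"
  shows "(\<lambda>n. L2_inner M h (s n)) \<longlonglongrightarrow> L2_inner M h l"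
proof -
  have "(\<lambda>n. L2_inner M h (\<lambda>z. l z - s n z)) \<longlonglongrightarrow> 0"
  proof (rule Lim_null_comparison)
    have "\<bar>L2_inner M h (\<lambda>z. l z - s n z)\<bar> \<le> sqrt (L2_inner M h h) * L2_dist M l (s n)" for n
      using L2_inner_Cauchy_Schwarz[OF h L2_diff[OF l s]] by (simp add: L2_dist_eq)
    then show "\<forall>\<^sub>F n in sequentially. norm (L2_inner M h (\<lambda>z. l z - s n z))
                 \<le> sqrt (L2_inner M h h) * L2_dist M l (s n)"
      by simp
    show "(\<lambda>n. sqrt (L2_inner M h h) * L2_dist M l (s n)) \<longlonglongrightarrow> 0"
      using tendsto_mult_left[OF lim] by simp
  qed
  then have "(\<lambda>n. L2_inner M h l - L2_inner M h (s n)) \<longlonglongrightarrow> 0"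
    using s l h by (simp add: L2_inner_simps)
  from tendsto_diff[OF tendsto_const[of "L2_inner M h l"] this] show ?thesis
    by simp
qed

text \<open>The inner product of the two errors tends to 0 by Cauchy-Schwarz. Its expansion consists
  of the wanted term, a constant, and mixed terms in which only one argument varies.\<close>

lemma tendsto_L2_inner:
  assumes lim: "(\<lambda>n. L2_dist M l (s n)) \<longlonglongrightarrow> 0" "(\<lambda>n. L2_dist M l' (s' n)) \<longlonglongrightarrow> 0"
    and s: "\<And>n. s n \<in> L2 M" "\<And>n. s' n \<in> L2 M" and l: "l \<in> L2 M" "l' \<in> L2 M"
  shows "(\<lambda>n. L2_inner M (s n) (s' n)) \<longlonglongrightarrow> L2_inner M l l'"
proof -
  let ?e = "\<lambda>n z. l z - s n z" and ?e' = "\<lambda>n z. l' z - s' n z"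
  have "(\<lambda>n. L2_inner M (?e n) (?e' n)) \<longlonglongrightarrow> 0"
  proof (rule Lim_null_comparison)
    show "\<forall>\<^sub>F n in sequentially. norm (L2_inner M (?e n) (?e' n)) \<le> L2_dist M l (s n) * L2_dist M l' (s' n)"
      using L2_inner_Cauchy_Schwarz[OF L2_diff[OF l(1) s(1)] L2_diff[OF l(2) s(2)]]
      by (simp add: L2_dist_eq)
    show "(\<lambda>n. L2_dist M l (s n) * L2_dist M l' (s' n)) \<longlonglongrightarrow> 0"
      using tendsto_mult[OF lim] by simp
  qed
  moreover have "(\<lambda>n. L2_inner M l' (s n)) \<longlonglongrightarrow> L2_inner M l' l"
    "(\<lambda>n. L2_inner M l (s' n)) \<longlonglongrightarrow> L2_inner M l l'"
    by (auto intro!: tendsto_L2_inner_right lim s l)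
  ultimately have "(\<lambda>n. L2_inner M (?e n) (?e' n) + L2_inner M l' (s n) + L2_inner M l (s' n) - L2_inner M l l')
      \<longlonglongrightarrow> 0 + L2_inner M l' l + L2_inner M l l' - L2_inner M l l'"
    by (intro tendsto_intros)
  then show ?thesis
    using s l by (simp add: L2_inner_simps L2_inner_commute[of M l'])
qed

section \<open>Completeness\<close>

lemma (in prob_space) L2_integral_abs_le_L2_dist:
  assumes "f \<in> L2 M" "g \<in> L2 M"
  shows "integrable M (\<lambda>z. \<bar>f z - g z\<bar>)" "(\<integral>z. \<bar>f z - g z\<bar> \<partial>M) \<le> L2_dist M f g"
proof -
  let ?d = "\<lambda>z. \<bar>f z - g z\<bar>"
  \<comment> \<open>The constant 1 has norm 1 under a probability measure, so Cauchy-Schwarz against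
    it bounds the L1 distance by \<open>L2_dist\<close>.\<close>
  have 1: "(\<lambda>_. 1) \<in> L2 M"
    by (simp add: L2_def)
  have d: "?d \<in> L2 M"
    using L2_diff[OF assms] by (auto simp: L2_def)
  show "integrable M ?d"
    using integrable_L2_mult[OF d 1] by simp
  show "(\<integral>z. ?d z \<partial>M) \<le> L2_dist M f g"
    using L2_inner_Cauchy_Schwarz[OF d 1]
    by (simp add: L2_inner_def L2_dist_def prob_space power2_eq_square)
qed

text \<open>Riesz-Fischer: an L2 Cauchy sequence is L1 Cauchy, so a subsequence converges almost
  surely; Fatou's lemma then carries the Cauchy bound over to the pointwise limit.\<close>

lemma (in prob_space) L2_complete:
  assumes s: "\<And>n. s n \<in> L2 M"
    and Cauchy: "\<And>e. e > 0 \<Longrightarrow> \<exists>N. \<forall>i\<ge>N. \<forall>j\<ge>N. L2_dist M (s i) (s j) < e"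
  obtains l where "l \<in> L2 M" "(\<lambda>n. L2_dist M l (s n)) \<longlonglongrightarrow> 0"
proof -
  have int: "integrable M (s n)" for n
    using integrable_L2_mult[OF s[of n], of "\<lambda>_. 1"] by (simp add: L2_def)
  have "\<exists>N. \<forall>i\<ge>N. \<forall>j\<ge>N. (\<integral>z. norm (s i z - s j z) \<partial>M) < e" if e: "e > 0" for e
    using Cauchy[OF e] by (auto intro: le_less_trans[OF L2_integral_abs_le_L2_dist(2)[OF s s]])
  then obtain r where r: "strict_mono r" "AE z in M. Cauchy (\<lambda>i. s (r i) z)"
    using cauchy_L1_AE_cauchy_subseq[of M s] int by blast
  have [measurable]: "s n \<in> borel_measurable M" for n
    using s by measurable
  define l where "l z = lim (\<lambda>i. s (r i) z)" for z
  have [measurable]: "l \<in> borel_measurable M"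
    unfolding l_def by (rule borel_measurable_lim_metric) measurable
  have AE_lim: "AE z in M. (\<lambda>i. s (r i) z) \<longlonglongrightarrow> l z"
    using r(2) by eventually_elim (simp add: l_def Cauchy_convergent_iff convergent_LIMSEQ_iff)
  \<comment> \<open>Integrability is part of the claim: a Bochner integral that does not exist is 0
    by default, so a bound on \<open>L2_dist\<close> would not by itself put \<open>l\<close> into
    \<open>L2 M\<close>.\<close>
  have bound: "integrable M (\<lambda>z. (l z - s i z)\<^sup>2) \<and> L2_dist M l (s i) \<le> e"
    if e: "e > 0" and N: "\<forall>i\<ge>N. \<forall>j\<ge>N. L2_dist M (s i) (s j) < e" and i: "i \<ge> N" for e N i
  proof -
    have "(\<integral>\<^sup>+z. ennreal ((l z - s i z)\<^sup>2) \<partial>M) = (\<integral>\<^sup>+z. liminf (\<lambda>j. ennreal ((s (r j) z - s i z)\<^sup>2)) \<partial>M)"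
    proof (rule nn_integral_cong_AE)
      show "AE z in M. ennreal ((l z - s i z)\<^sup>2) = liminf (\<lambda>j. ennreal ((s (r j) z - s i z)\<^sup>2))"
        using AE_lim
      proof eventually_elim
        case (elim z)
        then have "(\<lambda>j. ennreal ((s (r j) z - s i z)\<^sup>2)) \<longlonglongrightarrow> ennreal ((l z - s i z)\<^sup>2)"
          by (intro tendsto_ennrealI tendsto_intros)
        then show ?case
          by (rule lim_imp_Liminf[OF sequentially_bot, symmetric])
      qed
    qed
    also have "\<dots> \<le> liminf (\<lambda>j. \<integral>\<^sup>+z. ennreal ((s (r j) z - s i z)\<^sup>2) \<partial>M)"
      by (rule nn_integral_liminf) measurable
    also have "\<dots> \<le> ennreal (e\<^sup>2)"
    proof (rule Liminf_le)
      have "(\<integral>\<^sup>+z. ennreal ((s (r j) z - s i z)\<^sup>2) \<partial>M) \<le> ennreal (e\<^sup>2)" if "j \<ge> N" for j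
      proof -
        have "r j \<ge> N"
          using that seq_suble[OF r(1), of j] by linarith
        then have "(L2_dist M (s (r j)) (s i))\<^sup>2 \<le> e\<^sup>2"
          using N i L2_dist_nonneg[of M] by (intro power_mono) (auto intro: less_imp_le)
        moreover have "(\<integral>\<^sup>+z. ennreal ((s (r j) z - s i z)\<^sup>2) \<partial>M) = ennreal ((L2_dist M (s (r j)) (s i))\<^sup>2)"
          using L2_diff[OF s s, of "r j" i] by (subst nn_integral_eq_integral) (auto simp: L2_def L2_dist_def)
        ultimately show ?thesis
          by (simp add: ennreal_leI)
      qed
      then show "\<forall>\<^sub>F j in sequentially. (\<integral>\<^sup>+z. ennreal ((s (r j) z - s i z)\<^sup>2) \<partial>M) \<le> ennreal (e\<^sup>2)"
        using eventually_sequentially by blast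
    qed simp
    finally have le: "(\<integral>\<^sup>+z. ennreal ((l z - s i z)\<^sup>2) \<partial>M) \<le> ennreal (e\<^sup>2)" .
    then have int2: "integrable M (\<lambda>z. (l z - s i z)\<^sup>2)"
      by (intro integrableI_nonneg) (auto intro: le_less_trans)
    then have "(\<integral>z. (l z - s i z)\<^sup>2 \<partial>M) \<le> e\<^sup>2"
      using le by (subst (asm) nn_integral_eq_integral) auto
    then have "L2_dist M l (s i) \<le> e"
      using e real_sqrt_le_mono[of _ "e\<^sup>2"] by (fastforce simp: L2_dist_def)
    with int2 show ?thesis by simp
  qed
  have "l \<in> L2 M"
  proof -
    obtain N where "\<forall>i\<ge>N. \<forall>j\<ge>N. L2_dist M (s i) (s j) < 1"
      using Cauchy[of 1] by auto
    then have "(\<lambda>z. l z - s N z) \<in> L2 M"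
      using bound[of 1 N N] by (auto simp: L2_def)
    from L2_add[OF this s[of N]] show ?thesis by simp
  qed
  moreover have "(\<lambda>n. L2_dist M l (s n)) \<longlonglongrightarrow> 0"
  proof (rule LIMSEQ_I)
    fix e :: real assume e: "e > 0"
    then obtain N where "\<forall>i\<ge>N. \<forall>j\<ge>N. L2_dist M (s i) (s j) < e / 2"
      using Cauchy[of "e / 2"] by auto
    then have "L2_dist M l (s i) < e" if "i \<ge> N" for i
      using bound[of "e / 2" N i] e that by auto
    then show "\<exists>N. \<forall>n\<ge>N. norm (L2_dist M l (s n) - 0) < e"
      by (auto simp: L2_dist_nonneg)
  qed
  ultimately show ?thesis by (rule that)
qed

subsection \<open>Closed subspaces and orthogonal projections\<close>

definition L2_subspace :: "'z measure \<Rightarrow> ('z \<Rightarrow> real) set \<Rightarrow> bool" where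
  "L2_subspace M S \<longleftrightarrow> S \<subseteq> L2 M \<and> (\<lambda>_. 0) \<in> S \<and>
     (\<forall>f\<in>S. \<forall>g\<in>S. (\<lambda>z. f z + g z) \<in> S) \<and> (\<forall>f\<in>S. \<forall>c. (\<lambda>z. c * f z) \<in> S)"

text \<open>\<open>L2_closure\<close> adds every square integrable function almost surely equal to a
  member, so a closed subspace is a union of almost sure equivalence classes.\<close>

definition L2_closed_subspace :: "'z measure \<Rightarrow> ('z \<Rightarrow> real) set \<Rightarrow> bool" where
  "L2_closed_subspace M S \<longleftrightarrow> L2_subspace M S \<and> L2_closure M S \<subseteq> S"

lemma L2_subspace_imp_L2: "L2_subspace M S \<Longrightarrow> f \<in> S \<Longrightarrow> f \<in> L2 M"
  by (auto simp: L2_subspace_def)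

lemma L2_subspace_zero: "L2_subspace M S \<Longrightarrow> (\<lambda>_. 0) \<in> S"
  by (simp add: L2_subspace_def)

lemma L2_subspace_add: "L2_subspace M S \<Longrightarrow> f \<in> S \<Longrightarrow> g \<in> S \<Longrightarrow> (\<lambda>z. f z + g z) \<in> S"
  by (simp add: L2_subspace_def)

lemma L2_subspace_scale: "L2_subspace M S \<Longrightarrow> f \<in> S \<Longrightarrow> (\<lambda>z. c * f z) \<in> S"
  by (simp add: L2_subspace_def)

lemma L2_subspace_diff:
  assumes "L2_subspace M S" "f \<in> S" "g \<in> S"
  shows "(\<lambda>z. f z - g z) \<in> S"
  using L2_subspace_add[OF assms(1,2) L2_subspace_scale[OF assms(1,3), of "-1"]] by simp

lemma L2_closureE:
  assumes "f \<in> L2_closure M S" "e > 0"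
  obtains g where "g \<in> S" "L2_dist M f g < e"
  using assms by (auto simp: L2_closure_def)

lemma L2_closed_subspace_limit:
  assumes "L2_closed_subspace M S" "\<And>n. s n \<in> S" "l \<in> L2 M" "(\<lambda>n. L2_dist M l (s n)) \<longlonglongrightarrow> 0"
  shows "l \<in> S"
proof -
  have "\<exists>g\<in>S. L2_dist M l g < e" if "e > 0" for e
    using LIMSEQ_D[OF assms(4) that] assms(2) L2_dist_nonneg[of M l] by fastforce
  then show ?thesis
    using assms(1,3) by (auto simp: L2_closed_subspace_def L2_closure_def)
qed

text \<open>This is the first-order condition at a minimum: \<open>c\<close> will be the squared
  norm of a direction and \<open>b\<close> its inner product with the residual.\<close>

lemma quadratic_nonneg_imp_zero:
  fixes b c :: real
  assumes nonneg: "\<And>t. 0 \<le> t\<^sup>2 * c - 2 * t * b" and c: "c \<ge> 0"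
  shows "b = 0"
proof (rule ccontr)
  assume "b \<noteq> 0"
  \<comment> \<open>The minimiser would be \<open>b / c\<close>; the added 1 keeps the denominator
    positive when \<open>c = 0\<close>.\<close>
  define u where "u = b / (c + 1)"
  have b: "b = u * (c + 1)"
    using c by (simp add: u_def)
  with \<open>b \<noteq> 0\<close> have "u\<^sup>2 > 0"
    by auto
  have "0 \<le> u\<^sup>2 * c - 2 * u * b"
    by (rule nonneg)
  also have "\<dots> = - (u\<^sup>2 * (c + 2))"
    by (simp add: b power2_eq_square algebra_simps)
  also have "\<dots> < 0"
    using c \<open>u\<^sup>2 > 0\<close> by simp
  finally show False by simp
qed

text \<open>Minimise the squared distance \<open>N\<close> to \<open>f\<close> over
  \<open>S\<close>. The parallelogram law makes a minimising sequence Cauchy, completeness gives a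
  limit, closedness puts it into \<open>S\<close>, and a first variation yields
  orthogonality.\<close>

theorem (in prob_space) L2_projection_exists:
  assumes S: "L2_closed_subspace M S" and f: "f \<in> L2 M"
  shows "\<exists>q\<in>S. \<forall>g\<in>S. L2_inner M (\<lambda>z. f z - q z) g = 0"
proof -
  have sub: "L2_subspace M S"
    using S by (simp add: L2_closed_subspace_def)
  note S_L2 = L2_subspace_imp_L2[OF sub]
  define N where "N g = L2_inner M (\<lambda>z. f z - g z) (\<lambda>z. f z - g z)" for g
  define d where "d = Inf (N ` S)"
  have bdd: "bdd_below (N ` S)"
    by (auto simp: bdd_below_def N_def intro: L2_inner_self_nonneg)
  have d_le: "d \<le> N g" if "g \<in> S" for g
    unfolding d_def using that bdd by (intro cInf_lower) auto
  have "\<exists>g\<in>S. N g < d + inverse (real (Suc n))" for n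
  proof -
    have "Inf (N ` S) < d + inverse (real (Suc n))"
      by (simp add: d_def)
    moreover have "N ` S \<noteq> {}"
      using L2_subspace_zero[OF sub] by blast
    ultimately show ?thesis
      using cInf_lessD[of "N ` S"] by blast
  qed
  then obtain s where s: "\<And>n. s n \<in> S" "\<And>n. N (s n) < d + inverse (real (Suc n))"
    by metis
  have parallelogram: "(L2_dist M g h)\<^sup>2 \<le> 2 * (N g - d) + 2 * (N h - d)" if "g \<in> S" "h \<in> S" for g h
  proof -
    \<comment> \<open>The midpoint lies in \<open>S\<close>, so \<open>N m\<close> is at least
      \<open>d\<close>; this turns the parallelogram law into a bound by the excesses of
      \<open>N g\<close> and \<open>N h\<close> over \<open>d\<close>.\<close>
    define m where "m = (\<lambda>z. 1 / 2 * (g z + h z))"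
    have mid: "m \<in> S"
      unfolding m_def by (rule L2_subspace_scale[OF sub L2_subspace_add[OF sub that]])
    let ?u = "\<lambda>z. f z - g z" and ?v = "\<lambda>z. f z - h z"
    have uv: "?u \<in> L2 M" "?v \<in> L2 M"
      using f S_L2 that by (auto intro: L2_diff)
    have "(L2_dist M g h)\<^sup>2 = L2_inner M (\<lambda>z. ?u z - ?v z) (\<lambda>z. ?u z - ?v z)"
      by (simp add: L2_dist_power2 L2_inner_def power2_commute flip: power2_eq_square)
    moreover have "(\<lambda>z. ?u z + ?v z) = (\<lambda>z. 2 * (f z - m z))"
      by (intro ext) (simp add: m_def field_simps)
    then have "L2_inner M (\<lambda>z. ?u z + ?v z) (\<lambda>z. ?u z + ?v z) = 4 * N m"
      by (simp only: N_def L2_inner_scale_left L2_inner_scale_right)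
    ultimately have "(L2_dist M g h)\<^sup>2 = 2 * N g + 2 * N h - 4 * N m"
      using L2_inner_self_add[OF uv] L2_inner_self_diff[OF uv] unfolding N_def by linarith
    with d_le[OF mid] show ?thesis by (simp add: algebra_simps)
  qed
  have "\<exists>N. \<forall>i\<ge>N. \<forall>j\<ge>N. L2_dist M (s i) (s j) < e" if e: "e > 0" for e
  proof -
    \<comment> \<open>Two excesses below \<open>e\<^sup>2 / 4\<close> make the parallelogram bound
      smaller than \<open>e\<^sup>2\<close>.\<close>
    obtain n where n: "inverse (real (Suc n)) < e\<^sup>2 / 4"
      using reals_Archimedean[of "e\<^sup>2 / 4"] e by auto
    have "L2_dist M (s i) (s j) < e" if "i \<ge> n" "j \<ge> n" for i j
    proof (rule power2_less_imp_less)
      have "N (s k) - d < e\<^sup>2 / 4" if "k \<ge> n" for k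
      proof -
        have "inverse (real (Suc k)) \<le> inverse (real (Suc n))"
          using that by (intro le_imp_inverse_le) auto
        with s(2)[of k] n show ?thesis by linarith
      qed
      from this[OF \<open>i \<ge> n\<close>] this[OF \<open>j \<ge> n\<close>] show "(L2_dist M (s i) (s j))\<^sup>2 < e\<^sup>2"
        using parallelogram[OF s(1) s(1), of i j] by argo
    qed (use e in simp)
    then show ?thesis by blast
  qed
  then obtain q where q: "q \<in> L2 M" "(\<lambda>n. L2_dist M q (s n)) \<longlonglongrightarrow> 0"
    using L2_complete[of s] s(1) S_L2 by blast
  have "q \<in> S"
    by (rule L2_closed_subspace_limit[OF S s(1) q])
  have "N q \<le> d"
  proof (rule LIMSEQ_le)
    have "(\<lambda>n. L2_dist M (\<lambda>z. f z - q z) (\<lambda>z. f z - s n z)) \<longlonglongrightarrow> 0"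
      using q(2) by (simp add: L2_dist_def power2_commute)
    then show "(\<lambda>n. N (s n)) \<longlonglongrightarrow> N q"
      unfolding N_def by (intro tendsto_L2_inner L2_diff f S_L2 s q(1))
    show "(\<lambda>n. d + inverse (real (Suc n))) \<longlonglongrightarrow> d"
      using LIMSEQ_inverse_real_of_nat_add[of d] by simp
    show "\<exists>k. \<forall>n\<ge>k. N (s n) \<le> d + inverse (real (Suc n))"
      using s(2) less_imp_le by blast
  qed
  \<comment> \<open>Comparing \<open>N\<close> at \<open>q\<close> and at \<open>q + t * g\<close>
    gives a nonnegative quadratic in \<open>t\<close> whose linear coefficient is -2 times this
    inner product.\<close>
  have "L2_inner M (\<lambda>z. f z - q z) g = 0" if g: "g \<in> S" for g
  proof (rule quadratic_nonneg_imp_zero)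
    fix t
    have "(\<lambda>z. q z + t * g z) \<in> S"
      by (rule L2_subspace_add[OF sub \<open>q \<in> S\<close> L2_subspace_scale[OF sub g]])
    from d_le[OF this] \<open>N q \<le> d\<close> have "0 \<le> N (\<lambda>z. q z + t * g z) - N q"
      by linarith
    also have "\<dots> = t\<^sup>2 * L2_inner M g g - 2 * t * L2_inner M (\<lambda>z. f z - q z) g"
      using L2_inner_self_diff[OF L2_diff[OF f q(1)] L2_scale[OF S_L2[OF g], of t]]
      by (simp add: N_def L2_inner_scale_left L2_inner_scale_right diff_diff_eq power2_eq_square)
    finally show "0 \<le> t\<^sup>2 * L2_inner M g g - 2 * t * L2_inner M (\<lambda>z. f z - q z) g" .
  qed (rule L2_inner_self_nonneg)
  with \<open>q \<in> S\<close> show ?thesis by blast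
qed

text \<open>A nonzero functional has a closed kernel \<open>K\<close> of codimension one. For some
  \<open>h\<close> outside \<open>K\<close>, the part \<open>w\<close> of \<open>h\<close>
  orthogonal to \<open>K\<close> represents the functional after rescaling.\<close>

theorem (in prob_space) L2_Riesz_representation:
  assumes add: "\<And>f g. \<lbrakk>f \<in> L2 M; g \<in> L2 M\<rbrakk> \<Longrightarrow> L (\<lambda>z. f z + g z) = L f + L g"
    and scale: "\<And>f c. f \<in> L2 M \<Longrightarrow> L (\<lambda>z. c * f z) = c * L f"
    and cont: "\<And>f e. \<lbrakk>f \<in> L2 M; e > 0\<rbrakk> \<Longrightarrow> \<exists>\<delta>>0. \<forall>g\<in>L2 M. L2_dist M g f < \<delta> \<longrightarrow> \<bar>L g - L f\<bar> < e"
  shows "\<exists>b\<in>L2 M. \<forall>h\<in>L2 M. (L h :: real) = L2_inner M b h"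
proof (cases "\<forall>h\<in>L2 M. L h = 0")
  case True
  then show ?thesis
    by (intro bexI[of _ "\<lambda>_. 0"]) (auto simp: L2_inner_def L2_zero)
next
  case False
  then obtain h where h: "h \<in> L2 M" "L h \<noteq> 0" by blast
  have diff: "L (\<lambda>z. f z - g z) = L f - L g" if "f \<in> L2 M" "g \<in> L2 M" for f g
    using add[OF that(1) L2_scale[OF that(2), of "-1"]] scale[OF that(2), of "-1"] by simp
  have zero: "L (\<lambda>_. 0) = 0"
    using scale[OF L2_zero, of 0] by simp
  define K where "K = {f \<in> L2 M. L f = 0}"
  have "L2_closure M K \<subseteq> K"
  proof
    fix f assume f: "f \<in> L2_closure M K"
    then have f_L2: "f \<in> L2 M"
      by (simp add: L2_closure_def)
    have "L f = 0"
    proof (rule ccontr)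
      \<comment> \<open>Continuity with tolerance \<open>\<bar>L f\<bar>\<close> keeps
        \<open>L\<close> nonzero near \<open>f\<close>, whereas \<open>K\<close> comes arbitrarily
        close to \<open>f\<close>.\<close>
      assume "L f \<noteq> 0"
      then obtain \<delta> where \<delta>: "\<delta> > 0" "\<And>g. \<lbrakk>g \<in> L2 M; L2_dist M g f < \<delta>\<rbrakk> \<Longrightarrow> \<bar>L g - L f\<bar> < \<bar>L f\<bar>"
        using cont[OF f_L2, of "\<bar>L f\<bar>"] by auto
      obtain g where "g \<in> K" "L2_dist M f g < \<delta>"
        using f \<delta>(1) by (auto simp: L2_closure_def)
      with \<delta>(2)[of g] show False
        by (simp add: K_def L2_dist_commute[of M g f])
    qed
    with f_L2 show "f \<in> K" by (simp add: K_def)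
  qed
  then have K: "L2_closed_subspace M K"
    by (auto simp: L2_closed_subspace_def L2_subspace_def K_def add scale zero L2_intros)
  from L2_projection_exists[OF K h(1)] obtain q where
    q: "q \<in> K" and orth: "\<And>g. g \<in> K \<Longrightarrow> L2_inner M (\<lambda>z. h z - q z) g = 0"
    by blast
  define w where "w = (\<lambda>z. h z - q z)"
  have w: "w \<in> L2 M" "L w = L h" "\<And>g. g \<in> K \<Longrightarrow> L2_inner M w g = 0"
    using h(1) q orth by (auto simp: w_def K_def L2_intros diff)
  \<comment> \<open>That \<open>L w\<close> is nonzero does not at once exclude a null
    \<open>w\<close>, which need not be the zero function. Continuity does: it forces
    \<open>L\<close> to agree on functions at distance 0.\<close>
  have "L2_inner M w w \<noteq> 0"
  proof
    assume "L2_inner M w w = 0"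
    then have "L2_dist M (\<lambda>_. 0) w = 0"
      by (simp add: L2_dist_def L2_inner_def power2_eq_square)
    moreover obtain \<delta> where "\<delta> > 0" "\<And>g. \<lbrakk>g \<in> L2 M; L2_dist M g w < \<delta>\<rbrakk> \<Longrightarrow> \<bar>L g - L w\<bar> < \<bar>L w\<bar>"
      using cont[OF w(1), of "\<bar>L w\<bar>"] w(2) h(2) by auto
    ultimately have "\<bar>L (\<lambda>_. 0) - L w\<bar> < \<bar>L w\<bar>"
      using L2_zero[of M] by simp
    then show False by (simp add: zero)
  qed
  show ?thesis
  proof (intro bexI ballI)
    fix g assume g: "g \<in> L2 M"
    \<comment> \<open>Subtracting this multiple of \<open>w\<close> cancels the value of
      \<open>L\<close>, so the remainder lies in \<open>K\<close> and is orthogonal to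
      \<open>w\<close>.\<close>
    have "(\<lambda>z. g z - L g / L w * w z) \<in> K"
      using g w(1,2) h(2) scale[OF w(1), of "L g / L w"]
      by (simp add: K_def L2_intros diff del: times_divide_eq_left) simp
    from w(3)[OF this] have "L2_inner M w g = L g / L w * L2_inner M w w"
      using L2_inner_diff_right[OF g L2_scale[OF w(1)] w(1), of "L g / L w"]
      by (simp only: L2_inner_scale_right)
    then show "L g = L2_inner M (\<lambda>z. L w / L2_inner M w w * w z) g"
      using \<open>L2_inner M w w \<noteq> 0\<close> w(2) h(2)
      by (simp only: L2_inner_scale_left) simp
  qed (rule L2_scale[OF w(1)])
qed

theorem (in prob_space) L2_projections_onto_decreasing_subspaces:
  assumes S: "\<And>k. L2_closed_subspace M (S k)" and decr: "\<And>k. S (Suc k) \<subseteq> S k"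
    and f: "f \<in> L2 M"
    and q: "\<And>k. q k \<in> S k" "\<And>k g. g \<in> S k \<Longrightarrow> L2_inner M (\<lambda>z. f z - q k z) g = 0"
    and p: "p \<in> (\<Inter>k. S k)" "\<And>g. g \<in> (\<Inter>k. S k) \<Longrightarrow> L2_inner M (\<lambda>z. f z - p z) g = 0"
  shows "(\<lambda>k. L2_dist M p (q k)) \<longlonglongrightarrow> 0"
proof -
  have S_L2: "g \<in> L2 M" if "g \<in> S k" for g k
    using S[of k] that by (auto simp: L2_closed_subspace_def L2_subspace_def)
  have q_L2: "q k \<in> L2 M" for k
    by (rule S_L2[OF q(1)])
  have p_L2: "p \<in> L2 M"
    using p(1) S_L2 by blast
  have mono: "S j \<subseteq> S i" if "i \<le> j" for i j
    using decr that by (rule lift_Suc_antimono_le)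
  define a where "a k = L2_inner M (q k) (q k)" for k
  have dist: "(L2_dist M (q i) (q j))\<^sup>2 = a i - a j" if "i \<le> j" for i j
  proof -
    \<comment> \<open>The residuals of \<open>q i\<close> and \<open>q j\<close> are both orthogonal
      to \<open>q j\<close>; subtracting them shows that \<open>q i - q j\<close> is orthogonal to
      \<open>q j\<close>.\<close>
    have "q j \<in> S i"
      using q(1) mono[OF that] by blast
    from q(2)[OF this] q(2)[OF q(1)[of j]] have "L2_inner M (q i) (q j) = a j"
      using f q_L2 by (simp add: L2_inner_simps a_def)
    then show ?thesis
      using q_L2 by (simp add: L2_dist_power2 L2_inner_simps L2_inner_commute[of M "q j" "q i"] a_def)
  qed
  have "decseq a"
    unfolding decseq_def by (metis dist zero_le_power2 diff_ge_0_iff_ge)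
  then have "Cauchy a"
    using decseq_convergent[of a 0] L2_inner_self_nonneg
    by (metis a_def LIMSEQ_imp_Cauchy)
  have "\<exists>N. \<forall>i\<ge>N. \<forall>j\<ge>N. L2_dist M (q i) (q j) < e" if e: "e > 0" for e
  proof -
    obtain N where N: "\<And>i j. \<lbrakk>i \<ge> N; j \<ge> N\<rbrakk> \<Longrightarrow> \<bar>a i - a j\<bar> < e\<^sup>2"
      using metric_CauchyD[OF \<open>Cauchy a\<close>, of "e\<^sup>2"] e by (auto simp: dist_real_def)
    have *: "L2_dist M (q i) (q j) < e" if "i \<ge> N" "i \<le> j" for i j
      using dist[OF that(2)] N[of i j] that e by (intro power2_less_imp_less[of _ e]) auto
    have "L2_dist M (q i) (q j) < e" if "i \<ge> N" "j \<ge> N" for i j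
      using *[of i j] *[of j i] that by (cases "i \<le> j") (auto simp: L2_dist_commute[of M "q j"])
    then show ?thesis by blast
  qed
  then obtain l where l: "l \<in> L2 M" "(\<lambda>k. L2_dist M l (q k)) \<longlonglongrightarrow> 0"
    using L2_complete[of q] q_L2 by blast
  have l_in: "l \<in> S k" for k
  proof (rule L2_closed_subspace_limit[OF S _ l(1)])
    \<comment> \<open>Membership in \<open>S k\<close> is guaranteed only from index
      \<open>k\<close> on, hence the shift.\<close>
    show "q (n + k) \<in> S k" for n
      using q(1) mono[of k "n + k"] by auto
    show "(\<lambda>n. L2_dist M l (q (n + k))) \<longlonglongrightarrow> 0"
      using l(2) by (rule LIMSEQ_ignore_initial_segment)
  qed
  have l_orth: "L2_inner M (\<lambda>z. f z - l z) g = 0" if g: "g \<in> (\<Inter>k. S k)" for g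
  proof -
    have g_L2: "g \<in> L2 M" using g S_L2 by blast
    \<comment> \<open>For \<open>g\<close> in the intersection these inner products do not depend on
      \<open>k\<close>, so the limit \<open>l\<close> inherits their value.\<close>
    have "L2_inner M g (q k) = L2_inner M g f" for k
      using q(2)[of g k] g f q_L2 g_L2 by (simp add: L2_inner_simps L2_inner_commute[of M g])
    then have "L2_inner M g l = L2_inner M g f"
      using tendsto_L2_inner_right[OF l(2) q_L2 l(1) g_L2] by (simp add: LIMSEQ_const_iff)
    then show ?thesis
      using f l(1) g_L2 by (simp add: L2_inner_simps L2_inner_commute[of M g])
  qed
  \<comment> \<open>This difference lies in the intersection and is orthogonal to the residuals of
    both \<open>p\<close> and \<open>l\<close>, hence to itself. The outcome is distance 0 rather
    than equality of functions, which suffices through the triangle inequality.\<close>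
  have "(\<lambda>z. p z - l z) \<in> (\<Inter>k. S k)"
    using L2_subspace_diff[of M "S k" p l for k] S p(1) l_in
    by (auto simp: L2_closed_subspace_def)
  from l_orth[OF this] p(2)[OF this] have "(L2_dist M p l)\<^sup>2 = 0"
    using f l(1) p_L2 by (simp add: L2_dist_power2 L2_inner_simps)
  then have "L2_dist M p l = 0" by simp
  then have "L2_dist M p (q k) \<le> L2_dist M l (q k)" for k
    using L2_dist_triangle[OF p_L2 l(1) q_L2[of k]] by simp
  then show ?thesis
    by (intro Lim_null_comparison[OF _ l(2)]) (auto simp: L2_dist_nonneg)
qed

section \<open>Linear spans, closures and tangent spaces\<close>

lemma linear_span_add_term:
  assumes "f \<in> linear_span S" "g \<in> S"
  shows "(\<lambda>z. f z + c * g z) \<in> linear_span S"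
proof -
  obtain n :: nat and a h where f: "f = (\<lambda>z. \<Sum>i<n. a i * h i z)" and h: "\<forall>i<n. h i \<in> S"
    using assms(1) by (auto simp: linear_span_def)
  \<comment> \<open>Sums in \<open>linear_span\<close> run over initial segments; the updates at
    \<open>n\<close> append one term and leave the others unchanged.\<close>
  have "(\<lambda>z. f z + c * g z) = (\<lambda>z. \<Sum>i<Suc n. (a(n := c)) i * (h(n := g)) i z)"
    by (simp add: f)
  moreover have "\<forall>i<Suc n. (h(n := g)) i \<in> S"
    using h assms(2) by (simp add: less_Suc_eq)
  ultimately show ?thesis
    unfolding linear_span_def by blast
qed

lemma linear_span_add:
  assumes "f \<in> linear_span S" "g \<in> linear_span S"
  shows "(\<lambda>z. f z + g z) \<in> linear_span S"
proof -
  have "(\<lambda>z. f z + (\<Sum>i<n. a i * h i z)) \<in> linear_span S" if "\<forall>i<n. h i \<in> S" for n :: nat and a h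
    using that
  proof (induction n)
    case 0
    then show ?case using assms(1) by simp
  next
    case (Suc n)
    then have "(\<lambda>z. (f z + (\<Sum>i<n. a i * h i z)) + a n * h n z) \<in> linear_span S"
      by (intro linear_span_add_term) auto
    then show ?case by (simp add: add.assoc)
  qed
  with assms(2) show ?thesis
    by (auto simp: linear_span_def)
qed

lemma L2_subspace_linear_span:
  assumes "S \<subseteq> L2 M"
  shows "L2_subspace M (linear_span S)"
  unfolding L2_subspace_def
proof (intro conjI ballI allI)
  show "linear_span S \<subseteq> L2 M"
    using assms by (auto simp: linear_span_def intro!: L2_sum L2_scale)
  show "(\<lambda>_. 0) \<in> linear_span S"
    unfolding linear_span_def by (auto intro!: exI[of _ "0 :: nat"])
  fix f c assume "f \<in> linear_span S"
  then obtain n :: nat and a h where f: "f = (\<lambda>z. \<Sum>i<n. a i * h i z)" and h: "\<forall>i<n. h i \<in> S"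
    by (auto simp: linear_span_def)
  have "(\<lambda>z. c * f z) = (\<lambda>z. \<Sum>i<n. (c * a i) * h i z)"
    by (simp add: f sum_distrib_left mult.assoc)
  then show "(\<lambda>z. c * f z) \<in> linear_span S"
    using h unfolding linear_span_def mem_Collect_eq
    by (intro exI[of _ n] exI[of _ "\<lambda>i. c * a i"] exI[of _ h]) simp
qed (rule linear_span_add)

lemma L2_closed_subspace_closure:
  assumes S: "L2_subspace M S"
  shows "L2_closed_subspace M (L2_closure M S)"
  unfolding L2_closed_subspace_def L2_subspace_def
proof (intro conjI ballI allI)
  note S_L2 = L2_subspace_imp_L2[OF S]
  have closure_L2: "g \<in> L2 M" if "g \<in> L2_closure M S" for g
    using that by (simp add: L2_closure_def)
  then show "L2_closure M S \<subseteq> L2 M" by blast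
  show "(\<lambda>_. 0) \<in> L2_closure M S"
    using L2_subspace_zero[OF S] by (auto simp: L2_closure_def L2_zero L2_dist_self intro!: bexI[of _ "\<lambda>_. 0"])
  show "L2_closure M (L2_closure M S) \<subseteq> L2_closure M S"
  proof
    fix f assume f: "f \<in> L2_closure M (L2_closure M S)"
    have "\<exists>h\<in>S. L2_dist M f h < e" if e: "e > 0" for e
    proof -
      obtain g where g: "g \<in> L2_closure M S" "L2_dist M f g < e / 2"
        using L2_closureE[OF f half_gt_zero[OF e]] .
      obtain h where h: "h \<in> S" "L2_dist M g h < e / 2"
        using L2_closureE[OF g(1) half_gt_zero[OF e]] .
      have "L2_dist M f h \<le> L2_dist M f g + L2_dist M g h"
        using f g h by (intro L2_dist_triangle) (auto simp: L2_closure_def S_L2)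
      with g h show ?thesis by (intro bexI[of _ h]) auto
    qed
    with f show "f \<in> L2_closure M S" by (simp add: L2_closure_def)
  qed
  fix f assume f: "f \<in> L2_closure M S"
  {
    fix g assume g: "g \<in> L2_closure M S"
    have "\<exists>h\<in>S. L2_dist M (\<lambda>z. f z + g z) h < e" if e: "e > 0" for e
    proof -
      obtain u where u: "u \<in> S" "L2_dist M f u < e / 2"
        using L2_closureE[OF f half_gt_zero[OF e]] .
      obtain v where v: "v \<in> S" "L2_dist M g v < e / 2"
        using L2_closureE[OF g half_gt_zero[OF e]] .
      have "L2_dist M (\<lambda>z. f z + g z) (\<lambda>z. u z + v z)
          \<le> L2_dist M (\<lambda>z. f z + g z) (\<lambda>z. u z + g z) + L2_dist M (\<lambda>z. u z + g z) (\<lambda>z. u z + v z)"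
        using f g u v by (intro L2_dist_triangle) (auto simp: closure_L2 S_L2 L2_add)
      also have "\<dots> = L2_dist M f u + L2_dist M g v"
        by (simp add: L2_dist_def)
      finally have "L2_dist M (\<lambda>z. f z + g z) (\<lambda>z. u z + v z) < e"
        using u v by simp
      moreover have "(\<lambda>z. u z + v z) \<in> S"
        by (rule L2_subspace_add[OF S u(1) v(1)])
      ultimately show ?thesis by blast
    qed
    then show "(\<lambda>z. f z + g z) \<in> L2_closure M S"
      using f g by (simp add: L2_closure_def L2_add)
  }
  fix c
  have "\<exists>h\<in>S. L2_dist M (\<lambda>z. c * f z) h < e" if e: "e > 0" for e
  proof -
    \<comment> \<open>The denominator \<open>\<bar>c\<bar> + 1\<close> is positive even for
      \<open>c = 0\<close>.\<close>
    have "e / (\<bar>c\<bar> + 1) > 0"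
      using e by (intro divide_pos_pos) auto
    then obtain u where u: "u \<in> S" "L2_dist M f u < e / (\<bar>c\<bar> + 1)"
      by (rule L2_closureE[OF f])
    have "L2_dist M (\<lambda>z. c * f z) (\<lambda>z. c * u z) = \<bar>c\<bar> * L2_dist M f u"
      by (rule L2_dist_scale)
    also have "\<dots> \<le> (\<bar>c\<bar> + 1) * L2_dist M f u"
      by (intro mult_right_mono) (auto simp: L2_dist_nonneg)
    also have "\<dots> < e"
      using u(2) by (simp add: pos_less_divide_eq mult.commute add_pos_nonneg)
    finally have "L2_dist M (\<lambda>z. c * f z) (\<lambda>z. c * u z) < e" .
    moreover have "(\<lambda>z. c * u z) \<in> S"
      by (rule L2_subspace_scale[OF S u(1)])
    ultimately show ?thesis by blast
  qed
  then show "(\<lambda>z. c * f z) \<in> L2_closure M S"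
    using f by (simp add: L2_closure_def L2_scale)
qed

text \<open>Scores lie in \<open>L2 P0\<close> by the definition of a submodel, so their span is a
  subspace for any model \<open>Q\<close>.\<close>

lemma L2_closed_subspace_tangent_space: "L2_closed_subspace P0 (tangent_space \<mu> Q P0)"
  unfolding tangent_space_def
  by (intro L2_closed_subspace_closure L2_subspace_linear_span)
    (auto simp: tangent_cone_def submodel_with_score_def)

lemma tangent_cone_mono: "Q \<subseteq> R \<Longrightarrow> tangent_cone \<mu> Q P0 \<subseteq> tangent_cone \<mu> R P0"
  unfolding tangent_cone_def submodel_with_score_def by blast

text \<open>Cone, span and closure are all monotone; hence decreasing models have decreasing tangent
  spaces.\<close>

lemma tangent_space_mono:
  assumes "Q \<subseteq> R"
  shows "tangent_space \<mu> Q P0 \<subseteq> tangent_space \<mu> R P0"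
proof -
  have "linear_span (tangent_cone \<mu> Q P0) \<subseteq> linear_span (tangent_cone \<mu> R P0)"
    unfolding linear_span_def using tangent_cone_mono[OF assms, of \<mu> P0] by blast
  then show ?thesis
    unfolding tangent_space_def L2_closure_def by blast
qed

section \<open>Existence behind the chosen representer and projections\<close>

lemma (in prob_space) riesz_representer_L2:
  fixes L :: "('a \<Rightarrow> real) \<Rightarrow> real ^ 'd"
  assumes L: "L2_continuous_linear M L"
  shows "(\<lambda>z. riesz_representer M L z $ i) \<in> L2 M"
proof -
  \<comment> \<open>The scalar Riesz theorem is applied to each component of \<open>L\<close>;
    assembling the components gives a witness for the property under \<open>SOME\<close>.\<close>
  have "\<exists>b\<in>L2 M. \<forall>h\<in>L2 M. L h $ i = L2_inner M b h" for i
  proof (rule L2_Riesz_representation)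
    fix f e assume "f \<in> L2 M" "(e :: real) > 0"
    then obtain \<delta> where \<delta>: "\<delta> > 0" "\<And>g. \<lbrakk>g \<in> L2 M; L2_dist M g f < \<delta>\<rbrakk> \<Longrightarrow> dist (L g) (L f) < e"
      using L unfolding L2_continuous_linear_def by meson
    have "\<bar>L g $ i - L f $ i\<bar> \<le> dist (L g) (L f)" for g
      using component_le_norm_cart[of "L g - L f" i] by (simp add: dist_norm)
    with \<delta> show "\<exists>\<delta>>0. \<forall>g\<in>L2 M. L2_dist M g f < \<delta> \<longrightarrow> \<bar>L g $ i - L f $ i\<bar> < e"
      by (meson le_less_trans)
  qed (use L in \<open>auto simp: L2_continuous_linear_def\<close>)
  then obtain b where b: "\<And>i. b i \<in> L2 M" "\<And>i h. h \<in> L2 M \<Longrightarrow> L h $ i = L2_inner M (b i) h"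
    by metis
  have "\<exists>b. (\<forall>i. (\<lambda>z. b z $ i) \<in> L2 M) \<and> (\<forall>h\<in>L2 M. L h = (\<chi> i. \<integral>z. b z $ i * h z \<partial>M))"
    using b by (intro exI[of _ "\<lambda>z. \<chi> i. b i z"]) (simp add: vec_eq_iff L2_inner_def)
  from someI_ex[OF this] show ?thesis
    unfolding riesz_representer_def by blast
qed

lemma (in prob_space) L2_projection:
  assumes "L2_closed_subspace M S" "f \<in> L2 M"
  shows L2_projection_mem: "L2_projection M S f \<in> S"
    and L2_projection_orthogonal: "g \<in> S \<Longrightarrow> L2_inner M (\<lambda>z. f z - L2_projection M S f z) g = 0"
proof -
  have "\<exists>q. q \<in> S \<and> (\<forall>g\<in>S. (\<integral>z. (f z - q z) * g z \<partial>M) = 0)"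
    using L2_projection_exists[OF assms] by (auto simp: L2_inner_def)
  from someI_ex[OF this]
  show "L2_projection M S f \<in> S"
    and "g \<in> S \<Longrightarrow> L2_inner M (\<lambda>z. f z - L2_projection M S f z) g = 0"
    unfolding L2_projection_def[symmetric] L2_inner_def by auto
qed

subsection \<open>Continuity of matrix inversion\<close>

lemma matrix_inv_right:
  fixes A :: "real ^ 'n ^ 'n"
  assumes "invertible A"
  shows "A ** matrix_inv A = mat 1"
  using someI_ex[OF assms[unfolded invertible_def]] by (simp add: matrix_inv_def)

text \<open>Column \<open>j\<close> of the inverse solves \<open>A *v x = axis j 1\<close>, to which
  Cramer's rule applies. Each entry becomes a quotient of polynomials in the entries of
  \<open>A\<close>, from which continuity can be read off.\<close>

lemma matrix_inv_component:
  fixes A :: "real ^ 'n ^ 'n"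
  assumes "invertible A"
  shows "matrix_inv A $ i $ j = det (\<chi> r c. if c = i then axis j 1 $ r else A $ r $ c) / det A"
proof -
  have "A *v (matrix_inv A *v axis j 1) = axis j 1"
    using assms by (simp add: matrix_vector_mul_assoc matrix_inv_right)
  then have "matrix_inv A *v axis j 1
      = (\<chi> i. det (\<chi> r c. if c = i then axis j 1 $ r else A $ r $ c) / det A)"
    using assms by (subst (asm) cramer) (simp_all add: invertible_det_nz)
  then show ?thesis
    by (simp add: matrix_vector_mult_basis column_def vec_eq_iff)
qed

lemma tendsto_det:
  fixes A :: "'a \<Rightarrow> real ^ 'n ^ 'n"
  assumes "\<And>i j. ((\<lambda>x. A x $ i $ j) \<longlongrightarrow> B $ i $ j) F"
  shows "((\<lambda>x. det (A x)) \<longlongrightarrow> det B) F"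
  unfolding det_def by (intro tendsto_intros assms)

lemma tendsto_matrix_inv:
  fixes A :: "'a \<Rightarrow> real ^ 'n ^ 'n"
  assumes lim: "(A \<longlongrightarrow> B) F" and B: "invertible B" and A: "\<And>x. invertible (A x)"
  shows "((\<lambda>x. matrix_inv (A x)) \<longlongrightarrow> matrix_inv B) F"
proof (intro vec_tendstoI)
  fix i j
  have comp: "((\<lambda>x. A x $ r $ c) \<longlongrightarrow> B $ r $ c) F" for r c
    by (intro tendsto_vec_nth lim)
  show "((\<lambda>x. matrix_inv (A x) $ i $ j) \<longlongrightarrow> matrix_inv B $ i $ j) F"
    unfolding matrix_inv_component[OF A] matrix_inv_component[OF B]
  proof (intro tendsto_divide tendsto_det)
    show "det B \<noteq> 0"
      using B by (simp add: invertible_det_nz)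
  qed (auto intro: comp)
qed

subsection \<open>Convergence of the information\<close>

theorem lemma1:
  fixes \<mu> P0 :: "'z measure"
    and P :: "'z measure set"
    and Pk :: "nat \<Rightarrow> 'z measure set"
    and \<psi> :: "'z measure \<Rightarrow> real ^ 'd"
    and d\<psi> :: "('z \<Rightarrow> real) \<Rightarrow> real ^ 'd"
  assumes "statistical_model \<mu> P"
    and "\<And>k. k \<ge> 1 \<Longrightarrow> statistical_model \<mu> (Pk k)"
    and "P0 \<in> P"
    and "\<And>k. k \<ge> 1 \<Longrightarrow> Pk (Suc k) \<subseteq> Pk k"
    and "P \<subseteq> (\<Inter>k\<in>{1..}. Pk k)"
    and "has_derivative_rel_tangent_cone \<mu> (Pk 1) P0 \<psi> d\<psi>"
    and "(\<Inter>k\<in>{1..}. tangent_space \<mu> (Pk k) P0) = tangent_space \<mu> P P0"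
    and "invertible (inverse_information \<mu> P0 d\<psi> P)"
    and "\<And>k. k \<ge> 1 \<Longrightarrow> invertible (inverse_information \<mu> P0 d\<psi> (Pk k))"
  shows "(\<lambda>k. fisher_information \<mu> P0 d\<psi> (Pk k)) \<longlonglongrightarrow> fisher_information \<mu> P0 d\<psi> P"
proof -
  interpret prob_space P0
    using assms(1,3) by (simp add: statistical_model_def)
  have rep: "(\<lambda>z. riesz_representer P0 d\<psi> z $ i) \<in> L2 P0" for i
    using assms(6) by (intro riesz_representer_L2) (simp add: has_derivative_rel_tangent_cone_def)
  \<comment> \<open>Separating model and component turns each coordinate of the projected
    representer into a real function to which the scalar results apply.\<close>
  define p where "p Q i z = projected_representer \<mu> P0 d\<psi> Q z $ i" for Q i z
  have p_eq: "p Q i = L2_projection P0 (tangent_space \<mu> Q P0) (\<lambda>z. riesz_representer P0 d\<psi> z $ i)" for Q i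
    by (simp add: p_def projected_representer_def fun_eq_iff)
  note closed = L2_closed_subspace_tangent_space[where \<mu> = \<mu> and ?P0.0 = P0]
  have p_mem: "p Q i \<in> tangent_space \<mu> Q P0" for Q i
    unfolding p_eq by (rule L2_projection_mem[OF closed rep])
  have p_orth: "L2_inner P0 (\<lambda>z. riesz_representer P0 d\<psi> z $ i - p Q i z) g = 0"
    if "g \<in> tangent_space \<mu> Q P0" for Q i g
    unfolding p_eq by (rule L2_projection_orthogonal[OF closed rep that])
  have p_L2: "p Q i \<in> L2 P0" for Q i
    using p_mem closed[of Q] by (auto simp: L2_closed_subspace_def L2_subspace_def)
  \<comment> \<open>The models are numbered from 1. Reindexing by \<open>Suc\<close> avoids
    \<open>Pk 0\<close>, about which nothing is assumed; the shift is undone at the end and does not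
    affect the limit.\<close>
  have "{1..} = range Suc"
    by (auto simp: image_iff Suc_le_eq gr0_conv_Suc)
  then have "(\<Inter>k\<in>{1..}. tangent_space \<mu> (Pk k) P0) = (\<Inter>k. tangent_space \<mu> (Pk (Suc k)) P0)"
    using \<open>{1..} = range Suc\<close> by simp
  then have Int: "(\<Inter>k. tangent_space \<mu> (Pk (Suc k)) P0) = tangent_space \<mu> P P0"
    using assms(7) by simp
  have "(\<lambda>k. L2_dist P0 (p P i) (p (Pk (Suc k)) i)) \<longlonglongrightarrow> 0" for i
  proof (rule L2_projections_onto_decreasing_subspaces[where f = "\<lambda>z. riesz_representer P0 d\<psi> z $ i"])
    show "tangent_space \<mu> (Pk (Suc (Suc k))) P0 \<subseteq> tangent_space \<mu> (Pk (Suc k)) P0" for k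
      by (rule tangent_space_mono) (simp add: assms(4))
  qed (simp_all add: closed rep p_mem p_orth Int)
  \<comment> \<open>The entries of the inverse information are these inner products, so joint
    continuity of the inner product gives entrywise convergence.\<close>
  then have "(\<lambda>k. L2_inner P0 (p (Pk (Suc k)) i) (p (Pk (Suc k)) j)) \<longlonglongrightarrow> L2_inner P0 (p P i) (p P j)" for i j
    by (intro tendsto_L2_inner p_L2)
  then have "(\<lambda>k. inverse_information \<mu> P0 d\<psi> (Pk (Suc k))) \<longlonglongrightarrow> inverse_information \<mu> P0 d\<psi> P"
    by (intro vec_tendstoI) (simp add: inverse_information_def L2_inner_def p_def)
  then have "(\<lambda>k. fisher_information \<mu> P0 d\<psi> (Pk (Suc k))) \<longlonglongrightarrow> fisher_information \<mu> P0 d\<psi> P"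
    unfolding fisher_information_def by (rule tendsto_matrix_inv) (simp_all add: assms(8,9))
  then show ?thesis by (rule LIMSEQ_imp_Suc)
qed

end
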